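(* For every $r\in\mathbb N$ there is no $r$-round GLOCAL algorithm (on trees with degrees $\le 3$) that $3$-colors the collection $EI^{r+1}_3$.
   Context: Let $T_\Delta$ be the infinite $\Delta$-regular tree and $T^r_\Delta$ the ball of radius $r$ around a vertex of $T_\Delta$ (rooted at that vertex). A labeled tree is a tree together with a map from its vertices to a set of labels. An $r$-round GLOCAL algorithm (on trees with degrees $\le\Delta$) is a partial function $\mathcal A_r$ from isomorphism classes of labeled rooted trees of maximum degree $\le\Delta$ and radius $\le r$ (measured from the root) to a set $\Sigma$. Running $\mathcal A_r$ on a labeled tree $G$ of maximum degree $\le\Delta$ means assigning to each vertex $v$ the value of $\mathcal A_r$ on the labeled isomorphism class of the ball $B_G(v,r)$ rooted at $v$ (this gives a partial vertex labeling of $G$). For a collection $\mathcal F$ of finite labeled trees of degrees $\le\Delta$, $\mathcal A_r$ $k$-colors $\mathcal F$ if for every $G\in\mathcal F$, running $\mathcal A_r$ on $G$ assigns to every vertex one of $k$ colors and yields a proper vertex coloring of $G$. $EI^{r+1}_3$ denotes the set of labelings of $T^{r+1}_3$ with labels in $\{0,1,2,3\}$ such that adjacent vertices receive different labels. *)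

theory Defs
  imports Main "HOL-Library.FuncSet"
begin

section \<open>Graphs and trees\<close>

text \<open>Simple undirected graphs, possibly infinite; an edge is stored as both of its
  orientations.\<close>

record 'v graph =
  verts :: "'v set"
  edges :: "('v \<times> 'v) set"

definition simple_graph :: "('v, 'z) graph_scheme \<Rightarrow> bool" where
  "simple_graph G \<longleftrightarrow> edges G \<subseteq> verts G \<times> verts G \<and> sym (edges G) \<and> irrefl (edges G)"

definition connected_graph :: "('v, 'z) graph_scheme \<Rightarrow> bool" where
  "connected_graph G \<longleftrightarrow> verts G \<noteq> {} \<and> (\<forall>u\<in>verts G. \<forall>v\<in>verts G. (u, v) \<in> (edges G)\<^sup>*)"

definition is_cycle :: "('v, 'z) graph_scheme \<Rightarrow> 'v list \<Rightarrow> bool" where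
  "is_cycle G c \<longleftrightarrow> 3 \<le> length c \<and> distinct c \<and>
     successively (\<lambda>u v. (u, v) \<in> edges G) c \<and> (last c, hd c) \<in> edges G"

definition is_tree :: "('v, 'z) graph_scheme \<Rightarrow> bool" where
  "is_tree G \<longleftrightarrow> simple_graph G \<and> connected_graph G \<and> (\<nexists>c. is_cycle G c)"

definition neighbors :: "('v, 'z) graph_scheme \<Rightarrow> 'v \<Rightarrow> 'v set" where
  "neighbors G v = {u. (v, u) \<in> edges G}"

definition max_degree_le :: "('v, 'z) graph_scheme \<Rightarrow> nat \<Rightarrow> bool" where
  "max_degree_le G \<Delta> \<longleftrightarrow> (\<forall>v\<in>verts G. finite (neighbors G v) \<and> card (neighbors G v) \<le> \<Delta>)"

text \<open>The vertices at distance at most \<open>r\<close> from \<open>v\<close>: those joined to \<open>v\<close> by a walk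
  with at most \<open>r\<close> edges.\<close>

definition ball_verts :: "('v, 'z) graph_scheme \<Rightarrow> 'v \<Rightarrow> nat \<Rightarrow> 'v set" where
  "ball_verts G v r = {u \<in> verts G. \<exists>n\<le>r. (v, u) \<in> edges G ^^ n}"

definition ball_graph :: "('v, 'z) graph_scheme \<Rightarrow> 'v \<Rightarrow> nat \<Rightarrow> ('v, 'z) graph_scheme" where
  "ball_graph G v r =
     G\<lparr>verts := ball_verts G v r,
       edges := edges G \<inter> (ball_verts G v r \<times> ball_verts G v r)\<rparr>"


section \<open>The regular tree\<close>

text \<open>The infinite \<open>\<Delta>\<close>-regular tree, realised (for \<open>\<Delta> \<ge> 2\<close>) as the Cayley graph of the free
  product of \<open>\<Delta>\<close> copies of the group of order two: vertices are the words over
  \<open>{0..<\<Delta>}\<close> without equal adjacent letters, and a word is adjacent to the words obtained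
  from it by adding or removing a first letter.\<close>

definition regular_tree :: "nat \<Rightarrow> nat list graph" where
  "regular_tree \<Delta> = (let V = {w. set w \<subseteq> {..<\<Delta>} \<and> distinct_adj w} in
     \<lparr>verts = V, edges = {(u, v). u \<in> V \<and> v \<in> V \<and> (\<exists>a. u = a # v \<or> v = a # u)}\<rparr>)"

definition regular_ball :: "nat \<Rightarrow> nat \<Rightarrow> nat list graph" where
  "regular_ball \<Delta> r = ball_graph (regular_tree \<Delta>) [] r"


section \<open>Labeled rooted trees and their isomorphism classes\<close>

record ('v, 'l) lgraph = "'v graph" +
  lab :: "'v \<Rightarrow> 'l"

type_synonym ('v, 'l) rooted = "('v, 'l) lgraph \<times> 'v"

definition rooted_tree :: "('v, 'l) rooted \<Rightarrow> bool" where
  "rooted_tree = (\<lambda>(T, x). is_tree T \<and> x \<in> verts T)"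

definition radius_le :: "('v, 'l) rooted \<Rightarrow> nat \<Rightarrow> bool" where
  "radius_le = (\<lambda>(T, x) r. verts T \<subseteq> ball_verts T x r)"

definition rooted_iso :: "('v, 'l) rooted \<Rightarrow> ('w, 'l) rooted \<Rightarrow> bool" where
  "rooted_iso = (\<lambda>(G, x) (H, y). \<exists>f. bij_betw f (verts G) (verts H) \<and> f x = y \<and>
     (\<forall>u\<in>verts G. \<forall>v\<in>verts G. (u, v) \<in> edges G \<longleftrightarrow> (f u, f v) \<in> edges H) \<and>
     (\<forall>u\<in>verts G. lab H (f u) = lab G u))"

text \<open>Rooted trees of bounded degree and radius are finite, so the isomorphism class of one
  (on any vertex type) is represented by the set of its isomorphic copies on natural
  numbers.\<close>

definition iso_class :: "('v, 'l) rooted \<Rightarrow> (nat, 'l) rooted set" where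
  "iso_class T = {T'. rooted_tree T' \<and> rooted_iso T T'}"


section \<open>GLOCAL algorithms\<close>

type_synonym ('l, 'c) glocal = "(nat, 'l) rooted set \<rightharpoonup> 'c"

definition glocal_algorithm :: "nat \<Rightarrow> nat \<Rightarrow> ('l, 'c) glocal \<Rightarrow> bool" where
  "glocal_algorithm \<Delta> r A \<longleftrightarrow>
     dom A \<subseteq> {iso_class T | T :: (nat, 'l) rooted.
                rooted_tree T \<and> max_degree_le (fst T) \<Delta> \<and> radius_le T r}"

definition run :: "nat \<Rightarrow> ('l, 'c) glocal \<Rightarrow> ('v, 'l) lgraph \<Rightarrow> 'v \<rightharpoonup> 'c" where
  "run r A G v = A (iso_class (ball_graph G v r, v))"

text \<open>The palette \<open>C\<close> is common to all members of \<open>F\<close>. It is any set of at most \<open>k\<close> outputs,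
  so that the definition is also adequate when there are fewer than \<open>k\<close> possible outputs.\<close>

definition k_colors :: "nat \<Rightarrow> ('l, 'c) glocal \<Rightarrow> nat \<Rightarrow> ('v, 'l) lgraph set \<Rightarrow> bool" where
  "k_colors r A k F \<longleftrightarrow> (\<exists>C. finite C \<and> card C \<le> k \<and>
     (\<forall>G\<in>F. (\<forall>v\<in>verts G. run r A G v \<in> Some ` C) \<and>
             (\<forall>(u, v)\<in>edges G. run r A G u \<noteq> run r A G v)))"

definition EI3 :: "nat \<Rightarrow> (nat list, nat) lgraph set" where
  "EI3 s = (let T = regular_ball 3 s in
     {\<lparr>verts = verts T, edges = edges T, lab = f\<rparr> | f.
        f \<in> verts T \<rightarrow>\<^sub>E {0, 1, 2, 3} \<and> (\<forall>(u, v)\<in>edges T. f u \<noteq> f v)})"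


section \<open>The regular tree is a regular tree\<close>

lemma regular_tree_edges_iff:
  "(u, v) \<in> edges (regular_tree \<Delta>) \<longleftrightarrow>
     u \<in> verts (regular_tree \<Delta>) \<and> v \<in> verts (regular_tree \<Delta>) \<and> (\<exists>a. u = a # v \<or> v = a # u)"
  by (simp add: regular_tree_def Let_def)

lemma simple_graph_regular_tree: "simple_graph (regular_tree \<Delta>)"
  by (auto simp: simple_graph_def regular_tree_def Let_def sym_def irrefl_def)

lemma regular_tree_Cons_D:
  "a # w \<in> verts (regular_tree \<Delta>) \<Longrightarrow> w \<in> verts (regular_tree \<Delta>)"
  by (cases w) (auto simp: regular_tree_def Let_def)

lemma connected_regular_tree: "connected_graph (regular_tree \<Delta>)"
proof -
  let ?E = "edges (regular_tree \<Delta>)"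
  have S: "sym (?E\<^sup>*)"
    using simple_graph_regular_tree by (auto simp: simple_graph_def intro: sym_rtrancl)
  have R: "(w, []) \<in> ?E\<^sup>*" if "w \<in> verts (regular_tree \<Delta>)" for w
    using that
  proof (induction w)
    case (Cons a w)
    have "(a # w, w) \<in> ?E"
      using Cons.prems regular_tree_Cons_D[OF Cons.prems] by (simp add: regular_tree_edges_iff)
    with Cons.IH[OF regular_tree_Cons_D[OF Cons.prems]] show ?case
      by (rule converse_rtrancl_into_rtrancl[rotated])
  qed simp
  have "(u, v) \<in> ?E\<^sup>*" if "u \<in> verts (regular_tree \<Delta>)" "v \<in> verts (regular_tree \<Delta>)" for u v
    using R[OF that(1)] R[OF that(2)] S by (meson rtrancl_trans symD)
  moreover have "[] \<in> verts (regular_tree \<Delta>)"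
    by (simp add: regular_tree_def)
  ultimately show ?thesis by (auto simp: connected_graph_def)
qed

text \<open>On a cycle, a word of maximal length would have two distinct shorter neighbors.\<close>

lemma no_cycle_regular_tree: "\<not> is_cycle (regular_tree \<Delta>) c"
proof
  let ?E = "edges (regular_tree \<Delta>)"
  assume c: "is_cycle (regular_tree \<Delta>) c"
  define n where "n = length c"
  have n: "3 \<le> n" using c by (simp add: is_cycle_def n_def)
  have E: "(c ! i, c ! (Suc i mod n)) \<in> ?E" if "i < n" for i
  proof (cases "Suc i < n")
    case True
    then show ?thesis using c by (auto simp: is_cycle_def successively_conv_nth n_def)
  next
    case False
    then have "i = n - 1" using that by simp
    moreover have "(c ! (n - 1), c ! 0) \<in> ?E"
      using c n by (metis is_cycle_def n_def hd_conv_nth last_conv_nth list.size(3) not_numeral_le_zero)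
    ultimately show ?thesis using n by simp
  qed
  obtain i where i: "i < n" "\<And>j. j < n \<Longrightarrow> length (c ! j) \<le> length (c ! i)"
  proof -
    let ?M = "Max ((\<lambda>j. length (c ! j)) ` {..<n})"
    have "?M \<in> (\<lambda>j. length (c ! j)) ` {..<n}" using n by (intro Max_in) (auto simp: lessThan_empty_iff)
    then obtain i where "i < n" "?M = length (c ! i)" by auto
    then show ?thesis using that[of i] by (metis Max_ge finite_imageI finite_lessThan imageI lessThan_iff)
  qed
  define p where "p = (if i = 0 then n - 1 else i - 1)"
  have p: "p < n" "Suc p mod n = i" using i n by (auto simp: p_def)
  define s where "s = Suc i mod n"
  have s: "s < n" using n by (simp add: s_def)
  have "p \<noteq> s"
  proof (cases "Suc i < n")
    case False
    then have "Suc i = n" using i(1) by simp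
    then show ?thesis using n by (auto simp: p_def s_def)
  qed (use n in \<open>auto simp: p_def s_def\<close>)
  have "c ! s = tl (c ! i)"
    using E[OF i(1)] i(2)[OF s] by (auto simp: regular_tree_edges_iff s_def)
  moreover have "c ! p = tl (c ! i)"
    using E[OF p(1)] i(2)[OF p(1)] p(2) by (auto simp: regular_tree_edges_iff)
  ultimately have "c ! p = c ! s" by simp
  with \<open>p \<noteq> s\<close> p(1) s c show False
    by (simp add: is_cycle_def n_def nth_eq_iff_index_eq)
qed

lemma is_tree_regular_tree: "is_tree (regular_tree \<Delta>)"
  by (simp add: is_tree_def simple_graph_regular_tree connected_regular_tree no_cycle_regular_tree)

lemma regular_tree_regular:
  assumes "w \<in> verts (regular_tree \<Delta>)"
  shows "finite (neighbors (regular_tree \<Delta>) w)" "card (neighbors (regular_tree \<Delta>) w) = \<Delta>"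
proof -
  have "finite (neighbors (regular_tree \<Delta>) w) \<and> card (neighbors (regular_tree \<Delta>) w) = \<Delta>"
  proof (cases w)
    case Nil
    have "neighbors (regular_tree \<Delta>) w = (\<lambda>a. [a]) ` {..<\<Delta>}"
      by (auto simp: Nil neighbors_def regular_tree_def Let_def)
    then show ?thesis by (simp add: card_image inj_on_def)
  next
    case (Cons b v)
    have b: "b < \<Delta>" using assms by (simp add: Cons regular_tree_def Let_def)
    have "v \<in> verts (regular_tree \<Delta>)" using assms Cons regular_tree_Cons_D by blast
    then have N: "neighbors (regular_tree \<Delta>) w = insert v ((\<lambda>a. a # w) ` ({..<\<Delta>} - {b}))"
      using assms by (auto simp: Cons neighbors_def regular_tree_def Let_def)
    have "v \<notin> (\<lambda>a. a # w) ` ({..<\<Delta>} - {b})" by (auto simp: Cons)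
    moreover have "card ((\<lambda>a. a # w) ` ({..<\<Delta>} - {b})) = \<Delta> - 1"
      using b by (subst card_image) (auto simp: inj_on_def)
    ultimately show ?thesis using N b by simp
  qed
  then show "finite (neighbors (regular_tree \<Delta>) w)" "card (neighbors (regular_tree \<Delta>) w) = \<Delta>"
    by auto
qed

end

theory Submission
  imports Defs
begin

text \<open>
  The proof adapts Marks' game argument. Words of the regular tree carry a proper edge coloring:
  the edge between \<open>w\<close> and \<open>a # w\<close> has color \<open>a\<close>. Identify the three outputs with the three edge
  colors. In the game for an edge color \<open>i\<close>, a root label is given and then, level by level, Alice
  labels the branch of the root in direction \<open>i\<close> and Bob answers on the other branches; Alice wins
  if the output at the root is not \<open>i\<close>. If for some root label Alice won for all \<open>i\<close>, playing her
  winning strategies against each other would yield a labeling without output. So for every root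
  label Bob wins for some \<open>i\<close>. Two of the four root labels share this \<open>i\<close>; putting these on the
  ends of an edge of color \<open>i\<close> and playing Bob's strategies against each other gives both ends the
  output \<open>i\<close>.
\<close>

section \<open>Re-rooting the regular tree\<close>

text \<open>Right multiplication by the generator \<open>i\<close>, an automorphism of the Cayley graph.\<close>

definition shift :: "nat \<Rightarrow> nat list \<Rightarrow> nat list" where
  "shift i w = (if w \<noteq> [] \<and> last w = i then butlast w else w @ [i])"

text \<open>Words grow at the front, so the last letter records the first step away from the root
  \<open>[]\<close>.\<close>

definition branch :: "nat \<Rightarrow> nat list set" where
  "branch i = {w. w \<noteq> [] \<and> last w = i}"

lemma mem_regular_tree:
  "w \<in> verts (regular_tree \<Delta>) \<longleftrightarrow> set w \<subseteq> {..<\<Delta>} \<and> distinct_adj w"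
  by (simp add: regular_tree_def Let_def)

lemma shift_Nil [simp]: "shift i [] = [i]"
  by (simp add: shift_def)

lemma shift_Cons: "w \<noteq> [] \<Longrightarrow> shift i (a # w) = a # shift i w"
  by (simp add: shift_def)

lemma shift_branch: "w \<in> branch i \<Longrightarrow> shift i w = butlast w"
  by (simp add: shift_def branch_def)

lemma length_shift_branch: "w \<in> branch i \<Longrightarrow> length (shift i w) = length w - 1"
  by (simp add: shift_branch)

lemma length_shift_le: "length (shift i w) \<le> Suc (length w)"
  by (auto simp: shift_def)

lemma shift_mem:
  assumes "i < \<Delta>" "w \<in> verts (regular_tree \<Delta>)"
  shows "shift i w \<in> verts (regular_tree \<Delta>)"
proof (cases "w \<in> branch i")
  case True
  then have w: "w = butlast w @ [i]"
    by (metis (mono_tags) append_butlast_last_id branch_def mem_Collect_eq)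
  have "distinct_adj (butlast w)"
    using assms(2) w by (metis distinct_adj_appendD1 mem_regular_tree)
  then show ?thesis
    using assms(2) in_set_butlastD by (fastforce simp: shift_branch[OF True] mem_regular_tree)
next
  case False
  then show ?thesis
    using assms by (auto simp: shift_def branch_def mem_regular_tree distinct_adj_append_iff)
qed

lemma shift_shift [simp]:
  assumes "w \<in> verts (regular_tree \<Delta>)"
  shows "shift i (shift i w) = w"
proof (cases "w \<in> branch i")
  case True
  then have w: "w = butlast w @ [i]"
    by (metis (mono_tags) append_butlast_last_id branch_def mem_Collect_eq)
  \<comment> \<open>As equal letters are never adjacent, deleting the final \<open>i\<close> leaves
    a word outside \<open>branch i\<close>, and the second \<open>shift\<close> appends
    \<open>i\<close> again.\<close>
  then have "butlast w = [] \<or> last (butlast w) \<noteq> i"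
    using assms by (metis distinct_adj_append_iff last_ConsL list.sel(1) mem_regular_tree not_Cons_self2)
  then show ?thesis
    using w by (auto simp: shift_branch[OF True] shift_def[of i "butlast w"])
next
  case False
  then show ?thesis by (auto simp: shift_def branch_def)
qed

text \<open>\<open>shift i\<close> reverses the edge between \<open>[]\<close> and
  \<open>[i]\<close>, hence exchanges its two sides.\<close>

lemma shift_mem_branch_iff:
  assumes "w \<in> verts (regular_tree \<Delta>)"
  shows "shift i w \<in> branch i \<longleftrightarrow> w \<notin> branch i"
proof (cases "w \<in> branch i")
  case True
  then have w: "w = butlast w @ [i]"
    by (metis (mono_tags) append_butlast_last_id branch_def mem_Collect_eq)
  then have "butlast w = [] \<or> last (butlast w) \<noteq> i"
    using assms by (metis distinct_adj_append_iff last_ConsL list.sel(1) mem_regular_tree not_Cons_self2)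
  then show ?thesis
    using True by (simp add: shift_branch) (auto simp: branch_def)
next
  case False
  then show ?thesis by (auto simp: shift_def branch_def)
qed

lemma shift_edge:
  assumes "i < \<Delta>" "(u, v) \<in> edges (regular_tree \<Delta>)"
  shows "(shift i u, shift i v) \<in> edges (regular_tree \<Delta>)"
proof -
  \<comment> \<open>The second alternative occurs for \<open>w = []\<close> and
    \<open>a = i\<close>, where the edge is reversed.\<close>
  have *: "\<exists>b. shift i (a # w) = b # shift i w \<or> shift i w = b # shift i (a # w)" for a w
    by (cases "w = []") (auto simp: shift_Cons, auto simp: shift_def)
  show ?thesis
    using assms * by (auto simp: regular_tree_edges_iff shift_mem)
qed

lemma shift_edge_iff:
  assumes "i < \<Delta>" "u \<in> verts (regular_tree \<Delta>)" "v \<in> verts (regular_tree \<Delta>)"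
  shows "(shift i u, shift i v) \<in> edges (regular_tree \<Delta>) \<longleftrightarrow> (u, v) \<in> edges (regular_tree \<Delta>)"
  using shift_edge[OF assms(1), of u v] shift_edge[OF assms(1), of "shift i u" "shift i v"] assms
  by auto


section \<open>Views in a labeled regular ball\<close>

lemma length_walk_regular_tree:
  "(v, u) \<in> edges (regular_tree \<Delta>) ^^ n \<Longrightarrow> length u \<le> length v + n"
  by (induction n arbitrary: u) (fastforce simp: regular_tree_edges_iff)+

lemma verts_regular_ball:
  "verts (regular_ball \<Delta> s) = {w \<in> verts (regular_tree \<Delta>). length w \<le> s}"
proof -
  have "([], w) \<in> edges (regular_tree \<Delta>) ^^ length w" if "w \<in> verts (regular_tree \<Delta>)" for w
    using that
  proof (induction w)
    case (Cons a w)
    then show ?case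
      using regular_tree_Cons_D[OF Cons.prems] by (auto simp: regular_tree_edges_iff)
  qed simp
  then show ?thesis
    using length_walk_regular_tree[where v = "[]" and \<Delta> = \<Delta>]
    by (fastforce simp: regular_ball_def ball_graph_def ball_verts_def)
qed

lemma edges_regular_ball:
  "edges (regular_ball \<Delta> s) =
     edges (regular_tree \<Delta>) \<inter> (verts (regular_ball \<Delta> s) \<times> verts (regular_ball \<Delta> s))"
  by (simp add: regular_ball_def ball_graph_def)

text \<open>Labelings live on the whole tree and are cut off only here; \<open>restrict\<close>
  matches the extensional functions in \<open>EI3\<close>.\<close>

definition labeled_ball :: "nat \<Rightarrow> nat \<Rightarrow> (nat list \<Rightarrow> 'l) \<Rightarrow> (nat list, 'l) lgraph" where
  "labeled_ball \<Delta> s f = \<lparr>verts = verts (regular_ball \<Delta> s), edges = edges (regular_ball \<Delta> s),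
     lab = restrict f (verts (regular_ball \<Delta> s))\<rparr>"

lemma walk_regular_ball:
  assumes "w \<in> verts (regular_tree \<Delta>)" "length w \<le> s"
  shows "([], w) \<in> edges (regular_ball \<Delta> s) ^^ length w"
  using assms
proof (induction w)
  case (Cons a w)
  then show ?case
    using regular_tree_Cons_D[OF Cons.prems(1)]
    by (auto simp: regular_tree_edges_iff edges_regular_ball verts_regular_ball)
qed simp

lemma relpow_map:
  assumes "(x, y) \<in> R ^^ n" "\<And>u v. (u, v) \<in> R \<Longrightarrow> (h u, h v) \<in> S"
  shows "(h x, h y) \<in> S ^^ n"
  using assms(1) by (induction n arbitrary: y) (use assms(2) in \<open>auto intro: relcompI\<close>)

lemma ball_verts_labeled_ball_Nil:
  assumes "r \<le> s"
  shows "ball_verts (labeled_ball \<Delta> s f) [] r = verts (regular_ball \<Delta> r)"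
proof -
  have "length u \<le> n" if "([], u) \<in> edges (regular_ball \<Delta> s) ^^ n" for u n
    using length_walk_regular_tree[OF relpow_map[where h = "\<lambda>x. x" and S = "edges (regular_tree \<Delta>)", OF that]]
    by (simp add: edges_regular_ball)
  then show ?thesis
    using walk_regular_ball[of _ \<Delta> s] assms
    by (fastforce simp: ball_verts_def labeled_ball_def verts_regular_ball)
qed

text \<open>\<open>shift i\<close> carries \<open>[]\<close> to \<open>[i]\<close> and lengthens
  words by at most one, so radius \<open>r + 1\<close> leaves room for the full
  \<open>r\<close>-ball about \<open>[i]\<close>.\<close>

lemma ball_verts_labeled_ball_generator:
  assumes "i < \<Delta>"
  shows "ball_verts (labeled_ball \<Delta> (r + 1) f) [i] r = shift i ` verts (regular_ball \<Delta> r)"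
proof (intro equalityI subsetI)
  fix u assume "u \<in> ball_verts (labeled_ball \<Delta> (r + 1) f) [i] r"
  then obtain n where u: "u \<in> verts (regular_tree \<Delta>)" "n \<le> r"
      "([i], u) \<in> edges (regular_ball \<Delta> (r + 1)) ^^ n"
    by (auto simp: ball_verts_def labeled_ball_def verts_regular_ball)
  have "(shift i [i], shift i u) \<in> edges (regular_tree \<Delta>) ^^ n"
    using u(3) by (rule relpow_map[where h = "shift i"])
      (auto simp: edges_regular_ball intro: shift_edge[OF assms])
  then have "length (shift i u) \<le> n"
    using length_walk_regular_tree by (fastforce simp: shift_def)
  then have "shift i u \<in> verts (regular_ball \<Delta> r)"
    using u shift_mem[OF assms u(1)] by (simp add: verts_regular_ball)
  then show "u \<in> shift i ` verts (regular_ball \<Delta> r)"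
    using shift_shift[OF u(1)] by (metis imageI)
next
  fix u assume "u \<in> shift i ` verts (regular_ball \<Delta> r)"
  then obtain w where w: "u = shift i w" "w \<in> verts (regular_tree \<Delta>)" "length w \<le> r"
    by (auto simp: verts_regular_ball)
  have "(shift i [], shift i w) \<in> edges (regular_ball \<Delta> (r + 1)) ^^ length w"
  proof (rule relpow_map[where h = "shift i"])
    show "([], w) \<in> edges (regular_ball \<Delta> r) ^^ length w"
      using w by (intro walk_regular_ball)
  next
    fix u v assume uv: "(u, v) \<in> edges (regular_ball \<Delta> r)"
    show "(shift i u, shift i v) \<in> edges (regular_ball \<Delta> (r + 1))"
      using uv shift_edge[OF assms, of u v] shift_mem[OF assms, of u] shift_mem[OF assms, of v]
        length_shift_le[of i u] length_shift_le[of i v]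
      by (auto simp: edges_regular_ball verts_regular_ball)
  qed
  then show "u \<in> ball_verts (labeled_ball \<Delta> (r + 1) f) [i] r"
    using w shift_mem[OF assms w(2)] length_shift_le[of i w]
    by (auto simp: ball_verts_def labeled_ball_def verts_regular_ball)
qed

section \<open>Rooted isomorphisms and equality of views\<close>

lemma rooted_isoI:
  assumes "bij_betw f (verts G) (verts H)" "f x = y"
    and "\<And>u v. u \<in> verts G \<Longrightarrow> v \<in> verts G \<Longrightarrow> (u, v) \<in> edges G \<longleftrightarrow> (f u, f v) \<in> edges H"
    and "\<And>u. u \<in> verts G \<Longrightarrow> lab H (f u) = lab G u"
  shows "rooted_iso (G, x) (H, y)"
  using assms unfolding rooted_iso_def by blast

lemma rooted_iso_sym:
  assumes "rooted_iso S T" "snd S \<in> verts (fst S)"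
  shows "rooted_iso T S"
proof -
  obtain G x H y where ST: "S = (G, x)" "T = (H, y)" by (cases S, cases T)
  obtain f where f: "bij_betw f (verts G) (verts H)" "f x = y"
      "\<And>u v. u \<in> verts G \<Longrightarrow> v \<in> verts G \<Longrightarrow> (u, v) \<in> edges G \<longleftrightarrow> (f u, f v) \<in> edges H"
      "\<And>u. u \<in> verts G \<Longrightarrow> lab H (f u) = lab G u"
    using assms(1) by (auto simp: rooted_iso_def ST)
  let ?g = "inv_into (verts G) f"
  have g: "?g w \<in> verts G" "f (?g w) = w" if "w \<in> verts H" for w
    using that f(1) by (auto simp: bij_betw_def inv_into_into f_inv_into_f)
  have "bij_betw ?g (verts H) (verts G)" by (rule bij_betw_inv_into[OF f(1)])
  moreover have "?g y = x"
    using f(1,2) assms(2) by (auto simp: ST bij_betw_def)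
  ultimately show ?thesis
    using f(3,4) g unfolding rooted_iso_def ST by (auto intro!: exI[of _ ?g]) metis+
qed

lemma rooted_iso_trans:
  assumes "rooted_iso S T" "rooted_iso T U"
  shows "rooted_iso S U"
proof -
  obtain G x H y K z where STU: "S = (G, x)" "T = (H, y)" "U = (K, z)"
    by (cases S, cases T, cases U)
  obtain f where f: "bij_betw f (verts G) (verts H)" "f x = y"
      "\<And>u v. u \<in> verts G \<Longrightarrow> v \<in> verts G \<Longrightarrow> (u, v) \<in> edges G \<longleftrightarrow> (f u, f v) \<in> edges H"
      "\<And>u. u \<in> verts G \<Longrightarrow> lab H (f u) = lab G u"
    using assms(1) by (auto simp: rooted_iso_def STU)
  obtain g where g: "bij_betw g (verts H) (verts K)" "g y = z"
      "\<And>u v. u \<in> verts H \<Longrightarrow> v \<in> verts H \<Longrightarrow> (u, v) \<in> edges H \<longleftrightarrow> (g u, g v) \<in> edges K"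
      "\<And>u. u \<in> verts H \<Longrightarrow> lab K (g u) = lab H u"
    using assms(2) by (auto simp: rooted_iso_def STU)
  have "f u \<in> verts H" if "u \<in> verts G" for u using f(1) that by (auto simp: bij_betw_def)
  then show ?thesis
    using bij_betw_trans[OF f(1) g(1)] f(2-4) g(2-4)
    unfolding rooted_iso_def STU by (auto intro!: exI[of _ "g \<circ> f"])
qed

lemma iso_class_cong:
  assumes "rooted_iso S T" "snd S \<in> verts (fst S)"
  shows "iso_class S = iso_class T"
  using rooted_iso_trans[OF assms(1)] rooted_iso_trans[OF rooted_iso_sym[OF assms]]
  unfolding iso_class_def by blast

text \<open>\<open>shift i\<close> is an isomorphism between the two views, so moving the root along
  an edge of color \<open>i\<close> amounts to composing the labeling with
  \<open>shift i\<close>.\<close>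

lemma run_labeled_ball_shift:
  assumes "i < \<Delta>" and fg: "\<And>w. w \<in> verts (regular_ball \<Delta> r) \<Longrightarrow> g w = f (shift i w)"
  shows "run r A (labeled_ball \<Delta> (r + 1) g) [] = run r A (labeled_ball \<Delta> (r + 1) f) [i]"
proof -
  let ?B = "verts (regular_ball \<Delta> r)"
  let ?S = "ball_graph (labeled_ball \<Delta> (r + 1) g) [] r"
  let ?T = "ball_graph (labeled_ball \<Delta> (r + 1) f) [i] r"
  have B: "u \<in> verts (regular_tree \<Delta>)" "u \<in> verts (regular_ball \<Delta> (r + 1))"
      "shift i u \<in> verts (regular_ball \<Delta> (r + 1))" if "u \<in> ?B" for u
    using that shift_mem[OF assms(1), of u] length_shift_le[of i u]
    by (auto simp: verts_regular_ball)
  have S: "verts ?S = ?B"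
    by (simp only: ball_graph_def select_convs update_convs) (simp add: ball_verts_labeled_ball_Nil)
  have T: "verts ?T = shift i ` ?B"
    using ball_verts_labeled_ball_generator[OF assms(1)]
    by (simp add: ball_graph_def)
  have edge: "(u, v) \<in> edges ?S \<longleftrightarrow> (shift i u, shift i v) \<in> edges ?T" if "u \<in> ?B" "v \<in> ?B" for u v
    using that S T B[OF that(1)] B[OF that(2)] shift_edge_iff[OF assms(1), of u v]
    by (auto simp: ball_graph_def labeled_ball_def edges_regular_ball)
  have lab: "lab ?T (shift i u) = lab ?S u" if "u \<in> ?B" for u
    using B[OF that] fg[OF that] by (simp add: ball_graph_def labeled_ball_def)
  have "inj_on (shift i) ?B"
    by (rule inj_on_inverseI[of _ "shift i"]) (auto simp: verts_regular_ball)
  then have "bij_betw (shift i) (verts ?S) (verts ?T)"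
    unfolding S T by (rule inj_on_imp_bij_betw)
  then have "rooted_iso (?S, []) (?T, [i])"
    by (rule rooted_isoI) (use edge lab in \<open>simp_all only: S shift_Nil\<close>)
  moreover have "[] \<in> verts ?S"
    unfolding S by (simp add: verts_regular_ball mem_regular_tree)
  ultimately show ?thesis
    using iso_class_cong[of "(?S, [])" "(?T, [i])"] by (simp add: run_def)
qed


section \<open>Local colorings and the game\<close>

definition proper_labeling :: "nat \<Rightarrow> 'l set \<Rightarrow> (nat list \<Rightarrow> 'l) \<Rightarrow> bool" where
  "proper_labeling \<Delta> L f \<longleftrightarrow> (\<forall>w\<in>verts (regular_tree \<Delta>). f w \<in> L) \<and>
     (\<forall>(u, v)\<in>edges (regular_tree \<Delta>). f u \<noteq> f v)"

text \<open>Supplies proper labelings with a prescribed root label \<open>x\<close>.\<close>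

definition alternating :: "'l \<Rightarrow> 'l \<Rightarrow> nat list \<Rightarrow> 'l" where
  "alternating x y w = (if even (length w) then x else y)"

lemma proper_labelingI:
  assumes "\<And>w. w \<in> verts (regular_tree \<Delta>) \<Longrightarrow> f w \<in> L"
    and "\<And>a w. a # w \<in> verts (regular_tree \<Delta>) \<Longrightarrow> f (a # w) \<noteq> f w"
  shows "proper_labeling \<Delta> L f"
  using assms by (fastforce simp: proper_labeling_def regular_tree_edges_iff)

lemma proper_labeling_mem:
  "proper_labeling \<Delta> L f \<Longrightarrow> w \<in> verts (regular_tree \<Delta>) \<Longrightarrow> f w \<in> L"
  by (simp add: proper_labeling_def)

lemma proper_labeling_Cons:
  "proper_labeling \<Delta> L f \<Longrightarrow> a # w \<in> verts (regular_tree \<Delta>) \<Longrightarrow> f (a # w) \<noteq> f w"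
  using regular_tree_Cons_D[of a w \<Delta>]
  by (auto simp: proper_labeling_def regular_tree_edges_iff)

lemma proper_labeling_alternating:
  "x \<in> L \<Longrightarrow> y \<in> L \<Longrightarrow> x \<noteq> y \<Longrightarrow> proper_labeling \<Delta> L (alternating x y)"
  by (rule proper_labelingI) (auto simp: alternating_def)

lemma proper_labeling_shift:
  assumes "proper_labeling \<Delta> L f" "i < \<Delta>"
  shows "proper_labeling \<Delta> L (f \<circ> shift i)"
  using assms shift_edge[OF assms(2)] shift_mem[OF assms(2)]
  by (fastforce simp: proper_labeling_def)

text \<open>The algorithm in abstract form: \<open>c f\<close> is the output at the root. As
  \<open>f \<circ> shift i\<close> is \<open>f\<close> seen from \<open>[i]\<close>,
  \<open>color_shift\<close> is properness along the edges at the root.\<close>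

locale local_coloring =
  fixes \<Delta> r :: nat and L :: "'l set" and c :: "(nat list \<Rightarrow> 'l) \<Rightarrow> nat"
  assumes color_less: "proper_labeling \<Delta> L f \<Longrightarrow> c f < \<Delta>"
    and color_local: "(\<And>w. w \<in> verts (regular_ball \<Delta> r) \<Longrightarrow> f w = g w) \<Longrightarrow> c f = c g"
    and color_shift: "proper_labeling \<Delta> L f \<Longrightarrow> i < \<Delta> \<Longrightarrow> c (f \<circ> shift i) \<noteq> c f"
begin

definition agree :: "nat \<Rightarrow> (nat list \<Rightarrow> 'l) \<Rightarrow> (nat list \<Rightarrow> 'l) \<Rightarrow> bool" where
  "agree n f g \<longleftrightarrow> (\<forall>w\<in>verts (regular_ball \<Delta> n). f w = g w)"

text \<open>\<open>alice_wins i k f\<close>: Alice wins the game for \<open>i\<close> when \<open>k\<close> rounds remain and the levels up to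
  \<open>r - k\<close> are labeled according to \<open>f\<close>. A move is a labeling of the whole tree of which only one
  level of the branches of the player counts.\<close>

fun alice_wins :: "nat \<Rightarrow> nat \<Rightarrow> (nat list \<Rightarrow> 'l) \<Rightarrow> bool" where
  "alice_wins i 0 f \<longleftrightarrow> c f \<noteq> i"
| "alice_wins i (Suc k) f \<longleftrightarrow> (\<exists>a. proper_labeling \<Delta> L a \<and> agree (r - Suc k) a f \<and>
     (\<forall>g. proper_labeling \<Delta> L g \<and> agree (r - Suc k) g f \<and>
          (\<forall>w\<in>verts (regular_ball \<Delta> (r - k)) \<inter> branch i. g w = a w) \<longrightarrow> alice_wins i k g))"

lemma alice_wins_cong:
  assumes "agree (r - k) f g"
  shows "alice_wins i k f \<longleftrightarrow> alice_wins i k g"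
proof (cases k)
  case 0
  then show ?thesis using assms color_local[of f g] by (simp add: agree_def)
next
  case (Suc j)
  have "agree (r - Suc j) h f \<longleftrightarrow> agree (r - Suc j) h g" for h
    using assms by (auto simp: agree_def Suc)
  then show ?thesis by (simp add: Suc)
qed

text \<open>The branches partition the nonroot vertices, so winning moves for all \<open>i\<close>
  fit into one labeling, from which Alice still wins for every \<open>i\<close>. With no rounds
  left, the output itself is an \<open>i\<close> for which she loses.\<close>

lemma alice_not_always_wins:
  assumes "k \<le> r" "proper_labeling \<Delta> L f"
  shows "\<exists>i<\<Delta>. \<not> alice_wins i k f"
  using assms
proof (induction k arbitrary: f)
  case 0
  then show ?case using color_less by auto
next
  case (Suc k)
  show ?case
  proof (rule ccontr)
    let ?n = "r - Suc k"
    assume "\<not> ?thesis"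
    then have "\<forall>i\<in>{..<\<Delta>}. \<exists>a. proper_labeling \<Delta> L a \<and> agree ?n a f \<and>
        (\<forall>g. proper_labeling \<Delta> L g \<and> agree ?n g f \<and>
          (\<forall>w\<in>verts (regular_ball \<Delta> (r - k)) \<inter> branch i. g w = a w) \<longrightarrow> alice_wins i k g)"
      unfolding alice_wins.simps by (meson lessThan_iff)
    then obtain a where a: "\<And>i. i < \<Delta> \<Longrightarrow> proper_labeling \<Delta> L (a i)" "\<And>i. i < \<Delta> \<Longrightarrow> agree ?n (a i) f"
      and win: "\<And>i g. \<lbrakk>i < \<Delta>; proper_labeling \<Delta> L g; agree ?n g f;
          \<forall>w\<in>verts (regular_ball \<Delta> (r - k)) \<inter> branch i. g w = a i w\<rbrakk> \<Longrightarrow> alice_wins i k g"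
      unfolding lessThan_iff Ball_def by metis
    \<comment> \<open>All \<open>a i\<close> share the root label of \<open>f\<close>, which keeps
      the edges at the root proper.\<close>
    define g where "g w = (if w = [] then f w else a (last w) w)" for w
    have root: "a i [] = f []" if "i < \<Delta>" for i
      using a(2)[OF that] by (simp add: agree_def verts_regular_ball mem_regular_tree)
    have last: "last w < \<Delta>" if "w \<in> verts (regular_tree \<Delta>)" "w \<noteq> []" for w
      using that last_in_set[of w] unfolding mem_regular_tree by blast
    have "proper_labeling \<Delta> L g"
    proof (rule proper_labelingI)
      fix w assume w: "w \<in> verts (regular_tree \<Delta>)"
      show "g w \<in> L"
        using proper_labeling_mem[OF Suc.prems(2) w] proper_labeling_mem[OF a(1) w] last[OF w]
        by (auto simp: g_def)
    next
      fix b w assume w: "b # w \<in> verts (regular_tree \<Delta>)"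
      then show "g (b # w) \<noteq> g w"
        using proper_labeling_Cons[OF a(1) w, of "last (b # w)"] last[OF w] root[of b]
        by (auto simp: g_def)
    qed
    moreover have "agree ?n g f"
      using a(2) last by (auto simp: agree_def g_def verts_regular_ball)
    ultimately have "alice_wins i k g" if "i < \<Delta>" for i
      using win[OF that] by (simp add: branch_def g_def)
    then show False
      using Suc.IH[of g] Suc.prems(1) \<open>proper_labeling \<Delta> L g\<close> by auto
  qed
qed

text \<open>Bob's strategies at the two ends of an edge of color \<open>i\<close>: the branch of Alice at one end
  consists of the other end and of Bob's branches there.\<close>

lemma alice_wins_at_one_end:
  assumes "k \<le> r" "proper_labeling \<Delta> L f" "i < \<Delta>"
  shows "alice_wins i k f \<or> alice_wins i k (f \<circ> shift i)"
  using assms(1,2)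
proof (induction k arbitrary: f)
  case 0
  \<comment> \<open>Two losses would mean output \<open>i\<close> at both ends of the edge.\<close>
  then show ?case using color_shift[OF 0(2) assms(3)] by (metis alice_wins.simps(1))
next
  case (Suc k)
  let ?V = "verts (regular_tree \<Delta>)"
  let ?n = "r - Suc k"
  have n: "r - k = Suc ?n" using Suc.prems(1) by simp
  note f = Suc.prems(2)
  have f': "proper_labeling \<Delta> L (f \<circ> shift i)" by (rule proper_labeling_shift[OF f assms(3)])
  show ?case
  proof (rule ccontr)
    assume *: "\<not> ?thesis"
    \<comment> \<open>Alice plays \<open>f\<close> itself: the new level of her branch is one level
      closer to the other end, where \<open>f\<close> has already fixed it. Bob refutes this move by
      \<open>g\<close>, and at the other end by \<open>h\<close>.\<close>
    obtain g where g: "proper_labeling \<Delta> L g" "agree ?n g f" "\<not> alice_wins i k g"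
        "\<forall>w\<in>verts (regular_ball \<Delta> (r - k)) \<inter> branch i. g w = f w"
      using * f by (auto simp: agree_def)
    obtain h where h: "proper_labeling \<Delta> L h" "agree ?n h (f \<circ> shift i)" "\<not> alice_wins i k h"
        "\<forall>w\<in>verts (regular_ball \<Delta> (r - k)) \<inter> branch i. h w = (f \<circ> shift i) w"
      using * f' by (auto simp: agree_def)
    \<comment> \<open>Glues Bob's answers: \<open>g\<close> on the side of \<open>[]\<close> and
      \<open>h\<close>, transported by \<open>shift i\<close>, on the side of
      \<open>[i]\<close>.\<close>
    define m where "m w = (if w \<in> branch i then h (shift i w) else g w)" for w
    have root: "g [] = f []" "h [] = f [i]"
      using g(2) h(2) by (auto simp: agree_def verts_regular_ball mem_regular_tree)
    have m: "proper_labeling \<Delta> L m"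
    proof (rule proper_labelingI)
      fix w assume w: "w \<in> ?V"
      show "m w \<in> L"
        using proper_labeling_mem[OF g(1) w] proper_labeling_mem[OF h(1) shift_mem[OF assms(3) w]]
        by (simp add: m_def)
    next
      fix b w assume w: "b # w \<in> ?V"
      show "m (b # w) \<noteq> m w"
      proof (cases "w = []")
        \<comment> \<open>Only the edge from \<open>[]\<close> to \<open>[i]\<close> crosses between
          the sides; there \<open>m\<close> has the labels of \<open>f\<close>.\<close>
        case True
        have "m [] = f []" by (simp add: m_def branch_def root)
        moreover have "m [i] = f [i]" by (simp add: m_def branch_def root shift_def)
        moreover have "m [b] = g [b]" if "b \<noteq> i" using that by (simp add: m_def branch_def)
        ultimately show ?thesis
          using True w proper_labeling_Cons[OF f w] proper_labeling_Cons[OF g(1) w] root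
          by (cases "b = i") auto
      next
        case False
        have "b # shift i w \<in> ?V"
          using shift_mem[OF assms(3) w] False by (simp add: shift_Cons)
        then show ?thesis
          using False proper_labeling_Cons[OF g(1) w] proper_labeling_Cons[OF h(1)]
          by (auto simp: m_def branch_def shift_Cons)
      qed
    qed
    \<comment> \<open>On the branch, \<open>shift i\<close> shortens \<open>w\<close> to a level
      where \<open>h\<close> still agrees with \<open>f \<circ> shift i\<close>, while
      \<open>g\<close> equals \<open>f\<close> by Alice's move.\<close>
    have "m w = g w" if "w \<in> ?V" "length w \<le> Suc ?n" for w
    proof (cases "w \<in> branch i")
      case True
      then have "h (shift i w) = f w"
        using h(2) that shift_mem[OF assms(3) that(1)] length_shift_branch[OF True]
        by (simp add: agree_def verts_regular_ball)
      then show ?thesis using True g(4) that n by (simp add: m_def verts_regular_ball)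
    qed (simp add: m_def)
    then have "agree (r - k) m g" by (simp add: agree_def verts_regular_ball n)
    moreover have "m (shift i w) = h w" if "w \<in> ?V" "length w \<le> Suc ?n" for w
    proof (cases "w \<in> branch i")
      case True
      then have "g (shift i w) = f (shift i w)"
        using g(2) that shift_mem[OF assms(3) that(1)] length_shift_branch[OF True]
        by (simp add: agree_def verts_regular_ball)
      then show ?thesis
        using True h(4) that n by (simp add: m_def verts_regular_ball shift_mem_branch_iff)
    qed (use that in \<open>simp add: m_def shift_mem_branch_iff\<close>)
    then have "agree (r - k) (m \<circ> shift i) h" by (simp add: agree_def verts_regular_ball n)
    ultimately show False
      using Suc.IH[OF _ m] Suc.prems(1) g(3) h(3) alice_wins_cong by (metis Suc_leD)
  qed
qed

lemma card_labels_le: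
  assumes "finite L" "0 < \<Delta>"
  shows "card L \<le> \<Delta>"
proof (rule ccontr)
  assume card: "\<not> card L \<le> \<Delta>"
  have "\<exists>i<\<Delta>. \<forall>y. \<not> alice_wins i r (alternating x y)" if x: "x \<in> L" for x
  proof -
    have "\<not> L \<subseteq> {x}" using card assms card_mono[of "{x}" L] by auto
    then obtain z where z: "z \<in> L" "z \<noteq> x" by auto
    then obtain i where i: "i < \<Delta>" "\<not> alice_wins i r (alternating x z)"
      using alice_not_always_wins[of r] proper_labeling_alternating[OF x z(1)] z(2) by (metis order_refl)
    \<comment> \<open>With \<open>r\<close> rounds left only the root label counts, so the losing
      \<open>i\<close> depends on \<open>x\<close> alone.\<close>
    have "agree (r - r) (alternating x y) (alternating x z)" for y
      by (simp add: agree_def verts_regular_ball alternating_def)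
    then show ?thesis using i alice_wins_cong by blast
  qed
  then obtain d where d: "\<And>x. x \<in> L \<Longrightarrow> d x < \<Delta>"
      "\<And>x y. x \<in> L \<Longrightarrow> \<not> alice_wins (d x) r (alternating x y)"
    by metis
  have "\<not> inj_on d L"
    using card card_inj_on_le[of d L "{..<\<Delta>}"] d(1) by auto
  then obtain x y where xy: "x \<in> L" "y \<in> L" "x \<noteq> y" "d x = d y" by (auto simp: inj_on_def)
  let ?f = "alternating x y"
  \<comment> \<open>Seen from the other end of the edge, the root label is \<open>y\<close>.\<close>
  have "agree (r - r) (?f \<circ> shift (d x)) (alternating y x)"
    by (simp add: agree_def verts_regular_ball alternating_def)
  then have "\<not> alice_wins (d x) r (?f \<circ> shift (d x))"
    using alice_wins_cong d(2)[OF xy(2), of x] xy(4) by auto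
  then show False
    using alice_wins_at_one_end[of r ?f "d x"] proper_labeling_alternating[OF xy(1-3)] d xy(1)
    by auto
qed

end

section \<open>From GLOCAL algorithms to local colorings\<close>

lemma labeled_ball_mem_EI3:
  assumes "proper_labeling 3 {0, 1, 2, 3} f"
  shows "labeled_ball 3 s f \<in> EI3 s"
proof -
  let ?V = "verts (regular_ball 3 s)"
  have "restrict f ?V \<in> ?V \<rightarrow>\<^sub>E {0, 1, 2, 3}"
    using proper_labeling_mem[OF assms] by (auto simp: verts_regular_ball)
  moreover have "\<forall>(u, v)\<in>edges (regular_ball 3 s). restrict f ?V u \<noteq> restrict f ?V v"
    using assms by (auto simp: proper_labeling_def edges_regular_ball)
  ultimately show ?thesis
    unfolding EI3_def labeled_ball_def Let_def by blast
qed

theorem mainTheorem2: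
  fixes r :: nat
  shows "\<not> (\<exists>A :: (nat, 'c) glocal. glocal_algorithm 3 r A \<and> k_colors r A 3 (EI3 (r + 1)))"
proof
  assume "\<exists>A :: (nat, 'c) glocal. glocal_algorithm 3 r A \<and> k_colors r A 3 (EI3 (r + 1))"
  then obtain A :: "(nat, 'c) glocal" and C where C: "finite C" "card C \<le> 3"
    and A: "\<And>G v. G \<in> EI3 (r + 1) \<Longrightarrow> v \<in> verts G \<Longrightarrow> run r A G v \<in> Some ` C"
      "\<And>G u v. G \<in> EI3 (r + 1) \<Longrightarrow> (u, v) \<in> edges G \<Longrightarrow> run r A G u \<noteq> run r A G v"
    unfolding k_colors_def by blast
  \<comment> \<open>Identifies the outputs with edge colors.\<close>
  obtain e :: "'c \<Rightarrow> nat" where e: "inj_on e C" "e ` C \<subseteq> {..<3}"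
    using C card_le_inj[of C "{..<3::nat}"] by auto
  let ?L = "{0, 1, 2, 3 :: nat}"
  let ?out = "\<lambda>f. run r A (labeled_ball 3 (r + 1) f)"
  have Nil: "[] \<in> verts (labeled_ball 3 (r + 1) f)" for f :: "nat list \<Rightarrow> nat"
    by (simp add: labeled_ball_def verts_regular_ball mem_regular_tree)
  have edge: "([i], []) \<in> edges (labeled_ball 3 (r + 1) f)" if "i < 3" for i and f :: "nat list \<Rightarrow> nat"
    using that by (simp add: labeled_ball_def edges_regular_ball regular_tree_edges_iff
        verts_regular_ball mem_regular_tree)
  have out: "?out f [] \<in> Some ` C" if "proper_labeling 3 ?L f" for f
    by (rule A(1)[OF labeled_ball_mem_EI3[OF that] Nil])
  \<comment> \<open>As \<open>shift 0\<close> is an involution, both outputs equal that of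
    \<open>f \<circ> shift 0\<close> at \<open>[0]\<close>.\<close>
  have loc: "?out f [] = ?out g []"
    if "\<And>w. w \<in> verts (regular_ball 3 r) \<Longrightarrow> f w = g w" for f g :: "nat list \<Rightarrow> nat"
  proof -
    have *: "?out h [] = ?out (f \<circ> shift 0) [0]"
      if "\<And>w. w \<in> verts (regular_ball 3 r) \<Longrightarrow> h w = f w" for h
      using that by (intro run_labeled_ball_shift) (auto simp: verts_regular_ball)
    show ?thesis using *[of f] *[of g] that by simp
  qed
  have "local_coloring 3 r ?L (\<lambda>f. e (the (?out f [])))"
  proof
    fix f assume f: "proper_labeling 3 ?L f"
    show "e (the (?out f [])) < 3" using out[OF f] e(2) by auto
    fix i :: nat assume i: "i < 3"
    have "?out (f \<circ> shift i) [] = ?out f [i]" by (rule run_labeled_ball_shift[OF i]) simp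
    also have "\<dots> \<noteq> ?out f []" by (rule A(2)[OF labeled_ball_mem_EI3[OF f] edge[OF i]])
    finally show "e (the (?out (f \<circ> shift i) [])) \<noteq> e (the (?out f []))"
      using out[OF f] out[OF proper_labeling_shift[OF f i]] e(1) by (auto simp: inj_on_def)
  next
    fix f g :: "nat list \<Rightarrow> nat"
    assume "\<And>w. w \<in> verts (regular_ball 3 r) \<Longrightarrow> f w = g w"
    then show "e (the (?out f [])) = e (the (?out g []))" using loc[of f g] by simp
  qed
  then have "card ?L \<le> 3" by (rule local_coloring.card_labels_le) simp_all
  then show False by simp
qed

end
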